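(* Let $X$ be a scalar Gaussian random variable with non-zero mean value $\mu$ and variance $\sigma^2$. Given $n\in\mathbb{N}$, let $g:\mathbb{R}\to\mathbb{R}$ be a $C^n$ function for which the averages $\mathbb{E}\left[g(X)X^n\right]$ and $\mathbb{E}\left[g^{(j)}(X)\right]$, for $j=0,\ldots,n$, exist. Then $$\mathbb{E}\left[g(X)X^n\right]=\sum_{\ell=0}^n\binom{n}{\ell}\mu^{n-\ell}\sum_{k=0}^{\lfloor \ell/2\rfloor}H_{\ell,k}\,\sigma^{2(\ell-k)}\,\mathbb{E}\left[g^{(\ell-2k)}(X)\right],$$ where $\binom{n}{\ell}=\frac{n!}{\ell!(n-\ell)!}$ is the binomial coefficient and $$H_{\ell,k}=\frac{\ell!}{2^k\,k!\,(\ell-2k)!},\qquad k=0,\ldots,\lfloor \ell/2\rfloor.$$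
   Context: $\mathbb{E}[\cdot]$ is the mean value (expectation) operator. $X$ has density $\left(\sigma\sqrt{2\pi}\right)^{-1}\exp\left(-(x-\mu)^2/(2\sigma^2)\right)$ on $\mathbb{R}$. $g^{(j)}$ denotes the $j$th derivative of $g$, with $g^{(0)}:=g$, and $\lfloor\cdot\rfloor$ is the floor function. An average $\mathbb{E}[h(X)]$ exists when $h(X)$ is integrable. *)

theory Defs
  imports "HOL-Probability.Probability"
begin

(* The differentiability clause matters: deriv returns an arbitrary value at points where
   no derivative exists. Continuity of the derivatives of order below n follows from it. *)
definition C_n :: "nat \<Rightarrow> (real \<Rightarrow> real) \<Rightarrow> bool" where
  "C_n n g \<longleftrightarrow>
     (\<forall>j<n. \<forall>x. (deriv ^^ j) g differentiable (at x)) \<and> continuous_on UNIV ((deriv ^^ n) g)"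

definition H :: "nat \<Rightarrow> nat \<Rightarrow> real" where
  "H l k = fact l / (2 ^ k * fact k * fact (l - 2 * k))"

end

theory Submission
  imports Defs "HOL-Real_Asymp.Real_Asymp"
begin

text \<open>
  Write \<open>\<phi>\<close> for the density of \<open>X\<close>, \<open>Y = X - \<mu>\<close> for the centred variable, \<open>D j\<close> for the
  \<open>j\<close>th derivative of \<open>g\<close> and \<open>b m j\<close> for the mean of \<open>D j X * Y ^ m\<close>. By the binomial theorem
  for \<open>X = Y + \<mu>\<close>, the mean of \<open>g X * X ^ n\<close> is the sum of
  \<open>(n choose l) * \<mu> ^ (n - l) * b l 0\<close> over \<open>l \<le> n\<close>, so everything reduces to expressing
  \<open>b l 0\<close> by the unweighted means \<open>b 0 j\<close>.

  The engine is Stein's identity (\<open>normal_density_stein\<close>): if \<open>f\<close> is continuously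
  differentiable and \<open>f' (X)\<close> is integrable, then \<open>f (X) Y\<close> is integrable and its mean is \<open>\<sigma>\<^sup>2\<close>
  times that of \<open>f' (X)\<close>. That integrability is a conclusion here is essential, because
  the means \<open>b m j\<close> with \<open>m\<close> and \<open>j\<close> both positive are not assumed to exist. Applied to
  \<open>f x = D j x * (x - \<mu>) ^ m\<close> it shows, by induction on \<open>m\<close>, that \<open>b m j\<close> exists for
  \<open>m + j \<le> n\<close>, and it gives the recursion
  \<open>b (m + 1) j = \<sigma>\<^sup>2 * (b m (j + 1) + m * b (m - 1) j)\<close> (\<open>normal_density_moment_recursion\<close>).

  The recursion is solved by counting (\<open>matching_expansion\<close>). In evaluating \<open>b l 0\<close>, each of the
  \<open>l\<close> factors \<open>Y\<close> is either traded for a differentiation of \<open>g\<close> or paired with another factor, and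
  each differentiation and each pair contributes a factor \<open>\<sigma>\<^sup>2\<close>. Choosing \<open>k\<close> pairs can be done in \<open>H l k\<close> ways and
  leaves \<open>l - 2 * k\<close> differentiations, with weight \<open>\<sigma>\<close> to the power \<open>2 * (l - k)\<close>.
\<close>

section \<open>Stein's identity for the normal density\<close>

lemma normal_density_has_real_derivative:
  assumes "\<sigma> > 0"
  shows "(normal_density \<mu> \<sigma> has_real_derivative - ((x - \<mu>) * normal_density \<mu> \<sigma> x / \<sigma>\<^sup>2)) (at x)"
proof -
  define c where "c = 1 / sqrt (2 * pi * \<sigma>\<^sup>2)"
  have "normal_density \<mu> \<sigma> = (\<lambda>x. c * exp (- (x - \<mu>)\<^sup>2 / (2 * \<sigma>\<^sup>2)))"
    by (auto simp: normal_density_def c_def)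
  then show ?thesis
    using assms by (auto intro!: derivative_eq_intros simp: field_simps)
qed

lemma normal_density_tendsto_0:
  assumes "\<sigma> > 0"
  shows "(normal_density \<mu> \<sigma> \<longlongrightarrow> 0) at_top" "(normal_density \<mu> \<sigma> \<longlongrightarrow> 0) at_bot"
  unfolding normal_density_def using assms by real_asymp+

text \<open>
  Up to sign, \<open>(x - \<mu>) \<phi> x\<close> is the derivative of \<open>\<sigma>\<^sup>2 \<phi> x\<close>, and \<open>\<phi>\<close> vanishes at both
  infinities. Integrating away from \<open>\<mu>\<close>, over the ray that starts at \<open>t\<close>, keeps the integrand
  nonnegative and covers both sides of \<open>\<mu>\<close> by one formula.
\<close>

lemma normal_density_tail:
  fixes \<mu> \<sigma> :: real
  assumes s: "\<sigma> > 0"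
  defines "S \<equiv> \<lambda>t. if \<mu> < t then {t<..} else {..<t}"
  shows "set_integrable lborel (S t) (\<lambda>x. \<bar>x - \<mu>\<bar> * normal_density \<mu> \<sigma> x)" (is ?i)
    and "(LBINT x:S t. \<bar>x - \<mu>\<bar> * normal_density \<mu> \<sigma> x) = \<sigma>\<^sup>2 * normal_density \<mu> \<sigma> t" (is ?e)
proof -
  let ?\<phi> = "normal_density \<mu> \<sigma>"
  let ?w = "\<lambda>x. \<bar>x - \<mu>\<bar> * ?\<phi> x"
  have cont: "isCont ?\<phi> x" for x
    using normal_density_has_real_derivative[OF s] by (rule DERIV_isCont)
  have lim: "(?\<phi> \<longlongrightarrow> ?\<phi> t) (at_left t)" "(?\<phi> \<longlongrightarrow> ?\<phi> t) (at_right t)"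
    using cont[of t] by (simp_all add: isCont_def filterlim_at_split)
  have "?i \<and> ?e"
  proof (cases "\<mu> < t")
    case True
    have D: "DERIV (\<lambda>x. - (\<sigma>\<^sup>2 * ?\<phi> x)) x :> ?w x" if "ereal t < ereal x" "ereal x < \<infinity>" for x
      using that True s
      by (auto intro!: derivative_eq_intros normal_density_has_real_derivative)
    have C: "isCont ?w x" for x by (intro continuous_intros cont)
    have A: "(((\<lambda>x. - (\<sigma>\<^sup>2 * ?\<phi> x)) \<circ> real_of_ereal) \<longlongrightarrow> - (\<sigma>\<^sup>2 * ?\<phi> t)) (at_right (ereal t))"
      unfolding ereal_tendsto_simps by (intro tendsto_intros lim)
    have B: "(((\<lambda>x. - (\<sigma>\<^sup>2 * ?\<phi> x)) \<circ> real_of_ereal) \<longlongrightarrow> 0) (at_left \<infinity>)"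
      unfolding ereal_tendsto_simps
      using tendsto_minus[OF tendsto_mult_right_zero[OF normal_density_tendsto_0(1)[OF s]]] by simp
    have "set_integrable lborel (einterval t \<infinity>) ?w \<and> (LBINT x=t..\<infinity>. ?w x) = 0 - - (\<sigma>\<^sup>2 * ?\<phi> t)"
      by (intro conjI interval_integral_FTC_nonneg[OF _ D C _ A B]) auto
    then show ?thesis using True by (simp add: S_def interval_integral_Ioi)
  next
    case False
    have D: "DERIV (\<lambda>x. \<sigma>\<^sup>2 * ?\<phi> x) x :> ?w x" if "- \<infinity> < ereal x" "ereal x < ereal t" for x
      using that False s
      by (auto intro!: derivative_eq_intros normal_density_has_real_derivative simp: abs_if field_simps)
    have C: "isCont ?w x" for x by (intro continuous_intros cont)
    have B: "(((\<lambda>x. \<sigma>\<^sup>2 * ?\<phi> x) \<circ> real_of_ereal) \<longlongrightarrow> \<sigma>\<^sup>2 * ?\<phi> t) (at_left (ereal t))"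
      unfolding ereal_tendsto_simps by (intro tendsto_intros lim)
    have A: "(((\<lambda>x. \<sigma>\<^sup>2 * ?\<phi> x) \<circ> real_of_ereal) \<longlongrightarrow> 0) (at_right (-\<infinity>))"
      unfolding ereal_tendsto_simps
      by (intro tendsto_mult_right_zero normal_density_tendsto_0(2) s)
    have "set_integrable lborel (einterval (-\<infinity>) t) ?w \<and> (LBINT x=-\<infinity>..t. ?w x) = \<sigma>\<^sup>2 * ?\<phi> t - 0"
      by (intro conjI interval_integral_FTC_nonneg[OF _ D C _ A B]) auto
    then show ?thesis using False by (simp add: S_def interval_lebesgue_integral_def)
  qed
  then show ?i ?e by auto
qed

text \<open>
  Integration by parts on the whole line would need control of the boundary terms. Instead,
  \<open>f x - f \<mu>\<close> is written as the integral of \<open>f'\<close> between \<open>\<mu>\<close> and \<open>x\<close>, and the order of the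
  double integral is exchanged: for fixed \<open>t\<close>, the weight \<open>\<bar>x - \<mu>\<bar> \<phi> x\<close> is integrated over the
  \<open>x\<close> that lie beyond \<open>t\<close> as seen from \<open>\<mu>\<close>, which gives \<open>\<sigma>\<^sup>2 \<phi> t\<close>. The same computation with
  absolute values justifies the exchange and yields the integrability of \<open>f x (x - \<mu>)\<close>. The
  constant \<open>f \<mu>\<close> contributes nothing since the first centred moment is zero.
\<close>

theorem normal_density_stein:
  fixes f f' :: "real \<Rightarrow> real"
  assumes s: "\<sigma> > 0"
    and d: "\<And>x. (f has_real_derivative f' x) (at x)"
    and c: "continuous_on UNIV f'"
    and i: "integrable lborel (\<lambda>x. normal_density \<mu> \<sigma> x * f' x)"
  shows "integrable lborel (\<lambda>x. normal_density \<mu> \<sigma> x * (f x * (x - \<mu>)))" (is ?i)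
    and "(\<integral>x. normal_density \<mu> \<sigma> x * (f x * (x - \<mu>)) \<partial>lborel)
       = \<sigma>\<^sup>2 * (\<integral>x. normal_density \<mu> \<sigma> x * f' x \<partial>lborel)" (is ?e)
proof -
  let ?\<phi> = "normal_density \<mu> \<sigma>"
  define w where "w = (\<lambda>x. \<bar>x - \<mu>\<bar> * ?\<phi> x)"
  \<comment> \<open>\<open>t\<close> lies between \<open>\<mu>\<close> and \<open>x\<close>; the endpoint \<open>t = \<mu>\<close> goes to the left side only, so that for
    each fixed \<open>t\<close> the \<open>x\<close> with \<open>(t, x) \<in> B\<close> form exactly one of the rays in \<open>normal_density_tail\<close>\<close>
  define B where "B = {(t, x). \<mu> < t \<and> t < x \<or> x < t \<and> t \<le> \<mu>}"
  define K where "K = (\<lambda>(t, x). f' t * (indicator B (t, x) * w x))"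
  have [measurable]: "f' \<in> borel_measurable borel"
    using c by (rule borel_measurable_continuous_onI)
  have w_meas [measurable]: "w \<in> borel_measurable borel" unfolding w_def by measurable
  have w_nonneg: "w x \<ge> 0" for x by (simp add: w_def)
  have B_eq: "B = {p \<in> space (borel \<Otimes>\<^sub>M borel). \<mu> < fst p \<and> fst p < snd p \<or> snd p < fst p \<and> fst p \<le> \<mu>}"
    by (auto simp: B_def space_pair_measure)
  have B_meas [measurable]: "B \<in> sets (borel \<Otimes>\<^sub>M borel)" unfolding B_eq by measurable
  have K_meas: "K \<in> borel_measurable (lborel \<Otimes>\<^sub>M lborel)" unfolding K_def by measurable
  have indB: "indicator B (t, x) = (indicator (if \<mu> < t then {t<..} else {..<t}) x :: real)" for t x
    by (auto simp: B_def indicator_def)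
  have tail_i: "integrable lborel (\<lambda>x. indicator B (t, x) * w x)"
   and tail_e: "(\<integral>x. indicator B (t, x) * w x \<partial>lborel) = \<sigma>\<^sup>2 * ?\<phi> t" for t
    using normal_density_tail[OF s, of \<mu> t]
    unfolding indB w_def set_integrable_def set_lebesgue_integral_def by simp_all
  have sec: "(\<integral>x. K (t, x) \<partial>lborel) = \<sigma>\<^sup>2 * (?\<phi> t * f' t)" for t
    by (simp add: K_def tail_e)
  have nsec: "(\<integral>x. norm (K (t, x)) \<partial>lborel) = \<sigma>\<^sup>2 * \<bar>?\<phi> t * f' t\<bar>" for t
  proof -
    have "norm (K (t, x)) = \<bar>f' t\<bar> * (indicator B (t, x) * w x)" for x
      using w_nonneg by (simp add: K_def abs_mult)
    then show ?thesis by (simp add: tail_e abs_mult)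
  qed
  have K_int: "integrable (lborel \<Otimes>\<^sub>M lborel) K"
  proof (rule lborel_pair.Fubini_integrable[OF K_meas])
    show "integrable lborel (\<lambda>t. \<integral>x. norm (K (t, x)) \<partial>lborel)"
      unfolding nsec using i by (intro integrable_mult_right integrable_abs)
    show "AE t in lborel. integrable lborel (\<lambda>x. K (t, x))"
      unfolding K_def prod.case by (intro AE_I2 integrable_mult_right tail_i)
  qed
  have inner: "(\<integral>t. K (t, x) \<partial>lborel) = ?\<phi> x * (f x * (x - \<mu>)) - f \<mu> * (?\<phi> x * (x - \<mu>))" for x
  proof -
    have FTC: "(LBINT t=a..b. f' t) = f b - f a" for a b :: real
      by (rule interval_integral_FTC_finite)
        (auto intro: continuous_on_subset[OF c] has_field_derivative_at_within[OF d]
           simp: has_real_derivative_iff_has_vector_derivative[symmetric])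
    have "(\<integral>t. K (t, x) \<partial>lborel) = w x * (LBINT t:{t. (t, x) \<in> B}. f' t)"
      unfolding set_lebesgue_integral_def K_def
      by (subst integral_mult_right_zero[symmetric], rule Bochner_Integration.integral_cong) (auto simp: indicator_def)
    also have "\<dots> = ?\<phi> x * ((x - \<mu>) * (f x - f \<mu>))"
    proof (cases "\<mu> \<le> x")
      case True
      then have "{t. (t, x) \<in> B} = {\<mu><..<x}" by (auto simp: B_def)
      with FTC[of \<mu> x] True show ?thesis
        by (simp add: interval_integral_Ioo w_def)
    next
      case False
      then have sec_B: "{t. (t, x) \<in> B} = {x<..\<mu>}" by (auto simp: B_def)
      have w_x: "w x = (\<mu> - x) * ?\<phi> x" using False by (simp add: w_def)
      have increment: "(LBINT t:{x<..\<mu>}. f' t) = f \<mu> - f x"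
        using FTC[of x \<mu>] False by (simp add: interval_integral_Ioc)
      show ?thesis
        unfolding sec_B w_x increment by (simp add: algebra_simps)
    qed
    finally show ?thesis by (simp add: algebra_simps)
  qed
  have m: "integrable lborel (\<lambda>x. f \<mu> * (?\<phi> x * (x - \<mu>)))"
    using integrable_normal_moment[OF s, of \<mu> 1] by simp
  have m0: "(\<integral>x. ?\<phi> x * (x - \<mu>) \<partial>lborel) = 0"
    using integral_normal_moment_odd[OF s, of \<mu> 0] by simp
  have Ki: "integrable lborel (\<lambda>x. \<integral>t. K (t, x) \<partial>lborel)"
    using lborel_pair.integrable_snd[of "\<lambda>t x. K (t, x)"] K_int by simp
  then have "integrable lborel (\<lambda>x. (\<integral>t. K (t, x) \<partial>lborel) + f \<mu> * (?\<phi> x * (x - \<mu>)))"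
    using m by (rule Bochner_Integration.integrable_add)
  then show ii: ?i unfolding inner by simp
  have "(\<integral>x. (\<integral>t. K (t, x) \<partial>lborel) \<partial>lborel) = (\<integral>t. (\<integral>x. K (t, x) \<partial>lborel) \<partial>lborel)"
    using lborel_pair.Fubini_integral[of "\<lambda>t x. K (t, x)"] K_int by simp
  then show ?e unfolding inner sec
    by (subst (asm) Bochner_Integration.integral_diff[OF ii m]) (simp add: m0)
qed

section \<open>The coefficients and the recursion that they solve\<close>

text \<open>
  The number of ways to choose \<open>k\<close> disjoint pairs among \<open>l\<close> points. For \<open>2 * k > l\<close> the truncated
  subtraction in \<open>H\<close> would give a nonzero value; setting it to \<open>0\<close> there makes the
  recursion below unconditional and lets sums with different ranges be compared.
\<close>

definition matchings :: "nat \<Rightarrow> nat \<Rightarrow> real" where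
  "matchings l k = (if 2 * k \<le> l then H l k else 0)"

lemma matchings_0 [simp]: "matchings l 0 = 1"
  by (simp add: matchings_def H_def)

text \<open>
  Either the new point is unpaired, or it is paired with one of the \<open>l\<close> old points and the
  other \<open>k\<close> pairs come from the remaining \<open>l - 1\<close> points.
\<close>

lemma matchings_Suc_Suc:
  "matchings (Suc l) (Suc k) = matchings l (Suc k) + real l * matchings (l - 1) k"
proof (cases "l > 2 * k")
  case True
  then obtain r where l: "l = Suc (2 * k + r)"
    using less_imp_Suc_add by blast
  show ?thesis
  proof (cases r)
    \<comment> \<open>a perfect matching of the \<open>l + 1\<close> points: the new point cannot be left unpaired\<close>
    case 0
    have "(2 * (real k + 1) * ((2 * real k + 1) * F)) / (2 * p * ((real k + 1) * f))
        = (2 * real k + 1) * (F / (p * f))" if "p > 0" "f > 0" for F p f :: real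
      using that by (simp add: divide_simps)
    from this[of "2 ^ k" "fact k" "fact (2 * k)"] show ?thesis
      by (simp add: l 0 matchings_def H_def algebra_simps)
  next
    case (Suc q)
    define m where "m = 2 * real k + real q + 2"
    have "(m + 1) * (m * F) / (2 * p * ((real k + 1) * f) * ((real q + 1) * h))
        = m * F / (2 * p * ((real k + 1) * f) * h) + m * (F / (p * f * ((real q + 1) * h)))"
      if "p > 0" "f > 0" "h > 0" for F p f h :: real
      using that by (simp add: divide_simps m_def) (simp add: algebra_simps)
    from this[of "2 ^ k" "fact k" "fact q" "fact (l - 1)"] Suc show ?thesis
      by (simp add: l m_def matchings_def H_def add_ac)
  qed
next
  case False
  then have "l = 0 \<or> \<not> 2 * k \<le> l - 1" by auto
  with False show ?thesis by (auto simp: matchings_def)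
qed

lemma sum_H_eq_sum_matchings:
  assumes "l \<le> N"
  shows "(\<Sum>k=0..l div 2. H l k * c k) = (\<Sum>k\<le>N. matchings l k * c k)"
  using assms by (intro sum.mono_neutral_cong_left) (auto simp: matchings_def)

text \<open>
  The recursion trades one power of \<open>Y\<close> for a factor \<open>s\<close> and either one more derivative or
  the loss of a second power of \<open>Y\<close>. These are the two cases in the recursion of
  \<open>matchings\<close>, the second one shifting \<open>k\<close> by one.
\<close>

lemma matching_expansion:
  fixes b :: "nat \<Rightarrow> nat \<Rightarrow> real"
  assumes rec: "\<And>m j. Suc m + j \<le> n \<Longrightarrow> b (Suc m) j = s * (b m (Suc j) + real m * b (m - 1) j)"
    and "l + j \<le> n"
  shows "b l j = (\<Sum>k=0..l div 2. H l k * (s ^ (l - k) * b 0 (j + (l - 2 * k))))"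
  using assms(2)
proof (induction l arbitrary: j rule: less_induct)
  case (less l)
  show ?case
  proof (cases l)
    case 0
    then show ?thesis by (simp add: H_def)
  next
    case (Suc m)
    let ?c = "\<lambda>k. s ^ (Suc m - k) * b 0 (j + (Suc m - 2 * k))"
    have first: "s * b m (Suc j) = (\<Sum>k\<le>Suc m. matchings m k * ?c k)"
    proof -
      have "b m (Suc j) = (\<Sum>k\<le>Suc m. matchings m k * (s ^ (m - k) * b 0 (Suc j + (m - 2 * k))))"
        using less.IH[of m "Suc j"] less.prems Suc
        by (subst sum_H_eq_sum_matchings[where N = "Suc m", symmetric]) auto
      moreover have "s * (matchings m k * (s ^ (m - k) * b 0 (Suc j + (m - 2 * k)))) = matchings m k * ?c k" for k
        by (cases "2 * k \<le> m") (auto simp: matchings_def Suc_diff_le)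
      ultimately show ?thesis by (simp only: sum_distrib_left)
    qed
    have second: "s * (real m * b (m - 1) j) = (\<Sum>k\<le>m. real m * matchings (m - 1) k * ?c (Suc k))"
    proof (cases m)
      case 0
      then show ?thesis by simp
    next
      case m: (Suc q)
      have "b q j = (\<Sum>k\<le>m. matchings q k * (s ^ (q - k) * b 0 (j + (q - 2 * k))))"
        using less.IH[of q j] less.prems Suc m
        by (subst sum_H_eq_sum_matchings[where N = m, symmetric]) auto
      moreover have "s * (real m * (matchings q k * (s ^ (q - k) * b 0 (j + (q - 2 * k)))))
          = real m * matchings (m - 1) k * ?c (Suc k)" for k
        by (cases "2 * k \<le> q") (auto simp: matchings_def m Suc_diff_le)
      ultimately show ?thesis by (simp only: m sum_distrib_left diff_Suc_1)
    qed
    have "b l j = s * b m (Suc j) + s * (real m * b (m - 1) j)"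
      using rec[of m j] less.prems Suc by (simp add: distrib_left)
    also have "\<dots> = (\<Sum>k\<le>Suc m. matchings (Suc m) k * ?c k)"
      unfolding first second sum.atMost_Suc_shift
      by (simp add: matchings_Suc_Suc distrib_right sum.distrib)
    also have "\<dots> = (\<Sum>k=0..l div 2. H l k * ?c k)"
      using sum_H_eq_sum_matchings[of l "Suc m" ?c] Suc by simp
    finally show ?thesis using Suc by simp
  qed
qed

section \<open>Mixed moments of the derivatives\<close>

text \<open>
  This is Stein's identity for \<open>f x = D j x * (x - \<mu>) ^ m\<close>. The product rule expresses \<open>f'\<close> by
  products with at most \<open>m\<close> powers of \<open>x - \<mu>\<close>, so integrability propagates from \<open>m = 0\<close> upwards,
  as long as enough derivatives are left.
\<close>

lemma normal_density_moment_recursion: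
  fixes D :: "nat \<Rightarrow> real \<Rightarrow> real"
  assumes s: "\<sigma> > 0"
    and d: "\<And>j x. j < n \<Longrightarrow> (D j has_real_derivative D (Suc j) x) (at x)"
    and c: "\<And>j. j \<le> n \<Longrightarrow> continuous_on UNIV (D j)"
    and i: "\<And>j. j \<le> n \<Longrightarrow> integrable lborel (\<lambda>x. normal_density \<mu> \<sigma> x * D j x)"
  defines "b \<equiv> \<lambda>m j. \<integral>x. normal_density \<mu> \<sigma> x * (D j x * (x - \<mu>) ^ m) \<partial>lborel"
  shows "m + j \<le> n \<Longrightarrow> integrable lborel (\<lambda>x. normal_density \<mu> \<sigma> x * (D j x * (x - \<mu>) ^ m))"
    and "Suc m + j \<le> n \<Longrightarrow> b (Suc m) j = \<sigma>\<^sup>2 * (b m (Suc j) + real m * b (m - 1) j)"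
proof -
  let ?\<phi> = "normal_density \<mu> \<sigma>"
  let ?I = "\<lambda>m j. integrable lborel (\<lambda>x. ?\<phi> x * (D j x * (x - \<mu>) ^ m))"
  have step: "?I (Suc m) j \<and> b (Suc m) j = \<sigma>\<^sup>2 * (b m (Suc j) + real m * b (m - 1) j)"
    if le: "Suc m + j \<le> n" and I: "?I m (Suc j)" "?I (m - 1) j" for m j
  proof -
    let ?f = "\<lambda>x. D j x * (x - \<mu>) ^ m"
    let ?f' = "\<lambda>x. D (Suc j) x * (x - \<mu>) ^ m + real m * (D j x * (x - \<mu>) ^ (m - 1))"
    have eq: "?\<phi> x * ?f' x = ?\<phi> x * (D (Suc j) x * (x - \<mu>) ^ m)
        + real m * (?\<phi> x * (D j x * (x - \<mu>) ^ (m - 1)))" for x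
      by (simp add: algebra_simps)
    have f_deriv: "(?f has_real_derivative ?f' x) (at x)" for x
      using le by (auto intro!: derivative_eq_intros d)
    have f'_cont: "continuous_on UNIV ?f'"
      using le by (intro continuous_intros c) auto
    have f'_int: "integrable lborel (\<lambda>x. ?\<phi> x * ?f' x)"
      unfolding eq using I by (intro Bochner_Integration.integrable_add integrable_mult_right)
    have "(\<integral>x. ?\<phi> x * ?f' x \<partial>lborel) = b m (Suc j) + real m * b (m - 1) j"
      unfolding eq b_def using I by (simp add: integral_mult_right)
    with normal_density_stein[OF s f_deriv f'_cont f'_int] show ?thesis
      by (simp add: b_def mult_ac)
  qed
  have I: "?I m j" if "m + j \<le> n" for m j
    using that
  proof (induction m arbitrary: j rule: less_induct)
    case (less m)
    show ?case
    proof (cases m)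
      case 0
      then show ?thesis using i less.prems by simp
    next
      case (Suc k)
      then show ?thesis using step[of k j] less.IH[of k "Suc j"] less.IH[of "k - 1" j] less.prems i[of j]
        by (cases k) auto
    qed
  qed
  show "m + j \<le> n \<Longrightarrow> ?I m j" by (rule I)
  show "Suc m + j \<le> n \<Longrightarrow> b (Suc m) j = \<sigma>\<^sup>2 * (b m (Suc j) + real m * b (m - 1) j)"
    using step[of m j] I[of m "Suc j"] I[of "m - 1" j] by simp
qed

section \<open>Expansion of the weighted mean\<close>

theorem theorem2:
  fixes M :: "'a measure" and X :: "'a \<Rightarrow> real" and \<mu> \<sigma> :: real
    and n :: nat and g :: "real \<Rightarrow> real"
  assumes "prob_space M"
    and "\<sigma> > 0"
    and "distributed M lborel X (\<lambda>x. ennreal (normal_density \<mu> \<sigma> x))"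
    and "\<mu> \<noteq> 0"
    and "C_n n g"
    and "integrable M (\<lambda>\<omega>. g (X \<omega>) * X \<omega> ^ n)"
    and "\<And>j. j \<le> n \<Longrightarrow> integrable M (\<lambda>\<omega>. (deriv ^^ j) g (X \<omega>))"
  shows "(\<integral>\<omega>. g (X \<omega>) * X \<omega> ^ n \<partial>M) =
    (\<Sum>l=0..n. real (n choose l) * \<mu> ^ (n - l) *
      (\<Sum>k=0..l div 2. H l k * \<sigma> ^ (2 * (l - k)) *
        (\<integral>\<omega>. (deriv ^^ (l - 2 * k)) g (X \<omega>) \<partial>M)))"
proof -
  let ?\<phi> = "normal_density \<mu> \<sigma>"
  define D where "D = (\<lambda>j. (deriv ^^ j) g)"
  define b where "b = (\<lambda>m j. \<integral>x. ?\<phi> x * (D j x * (x - \<mu>) ^ m) \<partial>lborel)"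
  have d: "(D j has_real_derivative D (Suc j) x) (at x)" if "j < n" for j x
    using assms(5) that by (simp add: C_n_def D_def DERIV_deriv_iff_real_differentiable)
  have c: "continuous_on UNIV (D j)" if "j \<le> n" for j
  proof (cases "j = n")
    case True
    then show ?thesis using assms(5) by (simp add: C_n_def D_def)
  next
    case False
    with that have "j < n" by simp
    then show ?thesis
      by (intro continuous_at_imp_continuous_on ballI DERIV_isCont[OF d])
  qed
  have meas: "D j \<in> borel_measurable lborel" if "j \<le> n" for j
    using borel_measurable_continuous_onI[OF c[OF that]] by simp
  have i: "integrable lborel (\<lambda>x. ?\<phi> x * D j x)" if "j \<le> n" for j
    using distributed_integrable[OF assms(3) meas[OF that]] assms(7)[OF that] by (simp add: D_def)
  have E: "b 0 j = (\<integral>\<omega>. D j (X \<omega>) \<partial>M)" if "j \<le> n" for j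
    using distributed_integral[OF assms(3) meas[OF that]] by (simp add: b_def)
  have b_int: "integrable lborel (\<lambda>x. ?\<phi> x * (D 0 x * (x - \<mu>) ^ l))" if "l \<le> n" for l
    using normal_density_moment_recursion(1)[where D = D and n = n and m = l and j = 0, OF assms(2) d c i] that by simp
  have b_rec: "b (Suc m) j = \<sigma>\<^sup>2 * (b m (Suc j) + real m * b (m - 1) j)" if "Suc m + j \<le> n" for m j
    unfolding b_def using normal_density_moment_recursion(2)[where D = D and n = n, OF assms(2) d c i that] .
  have b_eq: "b l 0 = (\<Sum>k=0..l div 2. H l k * \<sigma> ^ (2 * (l - k)) *
        (\<integral>\<omega>. (deriv ^^ (l - 2 * k)) g (X \<omega>) \<partial>M))" if "l \<le> n" for l
    using matching_expansion[of n b "\<sigma>\<^sup>2" l 0, OF b_rec] that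
    by (simp add: E power_mult D_def mult.assoc)
  have "(\<integral>\<omega>. g (X \<omega>) * X \<omega> ^ n \<partial>M) = (\<integral>x. ?\<phi> x * (D 0 x * x ^ n) \<partial>lborel)"
    using distributed_integral[OF assms(3), of "\<lambda>x. D 0 x * x ^ n"] meas[of 0] by (simp add: D_def)
  also have "\<dots> = (\<integral>x. (\<Sum>l\<le>n. real (n choose l) * \<mu> ^ (n - l) * (?\<phi> x * (D 0 x * (x - \<mu>) ^ l))) \<partial>lborel)"
  proof (intro Bochner_Integration.integral_cong refl)
    fix x
    have "x ^ n = (\<Sum>l\<le>n. real (n choose l) * (x - \<mu>) ^ l * \<mu> ^ (n - l))"
      using binomial_ring[of "x - \<mu>" \<mu> n] by simp
    then show "?\<phi> x * (D 0 x * x ^ n) = (\<Sum>l\<le>n. real (n choose l) * \<mu> ^ (n - l) * (?\<phi> x * (D 0 x * (x - \<mu>) ^ l)))"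
      by (simp add: sum_distrib_left mult_ac)
  qed
  also have "\<dots> = (\<Sum>l\<le>n. real (n choose l) * \<mu> ^ (n - l) * b l 0)"
    using b_int by (subst Bochner_Integration.integral_sum) (auto simp: b_def)
  finally show ?thesis
    by (simp add: b_eq atMost_atLeast0)
qed

end
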